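(* Fix $\gamma_0>0$. The set $\{\mathcal{E}_{N_{\rm th},r,\Phi,t} : N_{\rm th}\ge 0,\ r\in\mathbb{R},\ \Phi\in\mathbb{R},\ t\ge 0\}$ of all squeezed generalized amplitude damping (SGAD) channels on a single qubit is not a convex subset of the real vector space of Hermiticity-preserving linear maps on $2\times 2$ complex matrices.
   Context: Let $\sigma_x,\sigma_y,\sigma_z$ be the standard Pauli matrices. The SGAD channel describes a qubit interacting with a squeezed thermal bath. Its parameters are: the spontaneous emission rate $\gamma_0>0$; the thermal photon number $N_{\rm th}=1/(e^{\hbar\omega/k_BT}-1)\ge 0$ (with fixed $\omega>0$, $N_{\rm th}$ ranges over $[0,\infty)$ as the temperature $T$ ranges over $[0,\infty)$, and $N_{\rm th}=0$ iff $T=0$); the bath squeezing parameters $r\in\mathbb{R}$ and $\Phi\in\mathbb{R}$; and the time $t\ge 0$. Put $$N=N_{\rm th}(\cosh^2 r+\sinh^2 r)+\sinh^2 r,\qquad a=\sinh(2r)(2N_{\rm th}+1),$$ $$A=\left[1+\tfrac12(e^{\gamma_0 a t}-1)(1+\cos\Phi)\right]e^{-\gamma_0(2N+1+a)t/2},$$ $$G=\left[1+\tfrac12(e^{\gamma_0 a t}-1)(1-\cos\Phi)\right]e^{-\gamma_0(2N+1+a)t/2},$$ $$B=\sin\Phi\,\sinh\!\left(\tfrac{\gamma_0 a t}{2}\right)e^{-\gamma_0(2N+1)t/2},\qquad H=e^{-\gamma_0(2N+1)t},\qquad Y=\frac{1-H}{2N+1}.$$ The SGAD channel $\mathcal{E}=\mathcal{E}_{N_{\rm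 th},r,\Phi,t}$ is the linear map on $2\times2$ complex matrices defined by $$\mathcal{E}(I)=I-Y\sigma_z,\quad \mathcal{E}(\sigma_x)=A\sigma_x-B\sigma_y,\quad \mathcal{E}(\sigma_y)=-B\sigma_x+G\sigma_y,\quad \mathcal{E}(\sigma_z)=H\sigma_z.$$ Equivalently, for a density matrix $\rho$ with Bloch components $x,y,z$, the state $\mathcal{E}(\rho)$ has Bloch components $Ax-By,\ Gy-Bx,\ Hz-Y$. *)

theory Defs
  imports "HOL-Analysis.Analysis"
begin

definition sigma_x :: "complex^2^2" where
  "sigma_x = vector [vector [0, 1], vector [1, 0]]"

definition sigma_y :: "complex^2^2" where
  "sigma_y = vector [vector [0, - \<i>], vector [\<i>, 0]]"

definition sigma_z :: "complex^2^2" where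
  "sigma_z = vector [vector [1, 0], vector [0, - 1]]"

(* The library's *s does not act entrywise on matrices. *)
definition cscale :: "complex \<Rightarrow> complex^2^2 \<Rightarrow> complex^2^2" where
  "cscale c M = (\<chi> i j. c * M $ i $ j)"

definition hermitian :: "complex^2^2 \<Rightarrow> bool" where
  "hermitian M \<longleftrightarrow> (\<forall>i j. M $ i $ j = cnj (M $ j $ i))"


definition sgad_N :: "real \<Rightarrow> real \<Rightarrow> real" where
  "sgad_N Nth r = Nth * ((cosh r)\<^sup>2 + (sinh r)\<^sup>2) + (sinh r)\<^sup>2"

definition sgad_a :: "real \<Rightarrow> real \<Rightarrow> real" where
  "sgad_a Nth r = sinh (2 * r) * (2 * Nth + 1)"

definition sgad_A :: "real \<Rightarrow> real \<Rightarrow> real \<Rightarrow> real \<Rightarrow> real \<Rightarrow> real" where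
  "sgad_A \<gamma>0 Nth r \<Phi> t =
     (1 + 1/2 * (exp (\<gamma>0 * sgad_a Nth r * t) - 1) * (1 + cos \<Phi>)) *
     exp (- (\<gamma>0 * (2 * sgad_N Nth r + 1 + sgad_a Nth r) * t / 2))"

definition sgad_G :: "real \<Rightarrow> real \<Rightarrow> real \<Rightarrow> real \<Rightarrow> real \<Rightarrow> real" where
  "sgad_G \<gamma>0 Nth r \<Phi> t =
     (1 + 1/2 * (exp (\<gamma>0 * sgad_a Nth r * t) - 1) * (1 - cos \<Phi>)) *
     exp (- (\<gamma>0 * (2 * sgad_N Nth r + 1 + sgad_a Nth r) * t / 2))"

definition sgad_B :: "real \<Rightarrow> real \<Rightarrow> real \<Rightarrow> real \<Rightarrow> real \<Rightarrow> real" where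
  "sgad_B \<gamma>0 Nth r \<Phi> t =
     sin \<Phi> * sinh (\<gamma>0 * sgad_a Nth r * t / 2) *
     exp (- (\<gamma>0 * (2 * sgad_N Nth r + 1) * t / 2))"

definition sgad_H :: "real \<Rightarrow> real \<Rightarrow> real \<Rightarrow> real \<Rightarrow> real" where
  "sgad_H \<gamma>0 Nth r t = exp (- (\<gamma>0 * (2 * sgad_N Nth r + 1) * t))"

definition sgad_Y :: "real \<Rightarrow> real \<Rightarrow> real \<Rightarrow> real \<Rightarrow> real" where
  "sgad_Y \<gamma>0 Nth r t = (1 - sgad_H \<gamma>0 Nth r t) / (2 * sgad_N Nth r + 1)"

(* The complex-linear map with prescribed images of I and the Pauli matrices, obtained from
   the expansion M = (tr(M) I + tr(sigma_x M) sigma_x + tr(sigma_y M) sigma_y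
   + tr(sigma_z M) sigma_z) / 2.  See sgad_channel_characterization below. *)
definition sgad_map ::
    "real \<Rightarrow> real \<Rightarrow> real \<Rightarrow> real \<Rightarrow> real \<Rightarrow> complex^2^2 \<Rightarrow> complex^2^2" where
  "sgad_map \<gamma>0 Nth r \<Phi> t M =
     cscale (trace M / 2) (mat 1 - sgad_Y \<gamma>0 Nth r t *\<^sub>R sigma_z) +
     cscale (trace (sigma_x ** M) / 2)
       (sgad_A \<gamma>0 Nth r \<Phi> t *\<^sub>R sigma_x - sgad_B \<gamma>0 Nth r \<Phi> t *\<^sub>R sigma_y) +
     cscale (trace (sigma_y ** M) / 2)
       (- sgad_B \<gamma>0 Nth r \<Phi> t *\<^sub>R sigma_x + sgad_G \<gamma>0 Nth r \<Phi> t *\<^sub>R sigma_y) +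
     cscale (trace (sigma_z ** M) / 2) (sgad_H \<gamma>0 Nth r t *\<^sub>R sigma_z)"

(* Elements of the type complex^2^2 =>_L complex^2^2 are the real-linear maps (boundedness is
   automatic in finite dimension).  It carries the library's real vector space structure, and
   the Hermiticity-preserving complex-linear maps form a real subspace of it. *)
definition sgad_channel ::
    "real \<Rightarrow> real \<Rightarrow> real \<Rightarrow> real \<Rightarrow> real \<Rightarrow> (complex^2^2) \<Rightarrow>\<^sub>L (complex^2^2)" where
  "sgad_channel \<gamma>0 Nth r \<Phi> t = Blinfun (sgad_map \<gamma>0 Nth r \<Phi> t)"

definition hermiticity_preserving_maps :: "((complex^2^2) \<Rightarrow>\<^sub>L (complex^2^2)) set" where
  "hermiticity_preserving_maps =
     {E. (\<forall>c M. blinfun_apply E (cscale c M) = cscale c (blinfun_apply E M)) \<and>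
         (\<forall>M. hermitian M \<longrightarrow> hermitian (blinfun_apply E M))}"

definition sgad_channels :: "real \<Rightarrow> ((complex^2^2) \<Rightarrow>\<^sub>L (complex^2^2)) set" where
  "sgad_channels \<gamma>0 = {sgad_channel \<gamma>0 Nth r \<Phi> t | Nth r \<Phi> t. Nth \<ge> 0 \<and> t \<ge> 0}"


lemmas matrix2_simps = sigma_x_def sigma_y_def sigma_z_def cscale_def trace_def
  matrix_matrix_mult_def mat_def vec_eq_iff forall_2 sum_2

lemma cscale_add: "cscale (c + d) M = cscale c M + cscale d M"
  by (simp add: cscale_def vec_eq_iff ring_distribs)

lemma cscale_add_right: "cscale c (M + M') = cscale c M + cscale c M'"
  by (simp add: cscale_def vec_eq_iff ring_distribs)

lemma cscale_cscale: "cscale c (cscale d M) = cscale (c * d) M"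
  by (simp add: cscale_def vec_eq_iff mult.assoc)

lemma cscale_of_real: "cscale (of_real k) M = k *\<^sub>R M"
  by (simp add: cscale_def vec_eq_iff) (simp add: scaleR_conv_of_real)

lemma trace_mult_cscale: "trace (P ** cscale c M) = c * trace (P ** M)"
  by (simp add: cscale_def trace_def matrix_matrix_mult_def sum_distrib_left mult.left_commute)

lemma trace_cscale: "trace (cscale c M) = c * trace M"
  by (simp add: cscale_def trace_def sum_distrib_left)

lemma sgad_map_cscale: "sgad_map \<gamma>0 Nth r \<Phi> t (cscale c M) = cscale c (sgad_map \<gamma>0 Nth r \<Phi> t M)"
  unfolding sgad_map_def trace_mult_cscale trace_cscale cscale_add_right cscale_cscale
  by (simp only: times_divide_eq_right)

lemma linear_sgad_map: "linear (sgad_map \<gamma>0 Nth r \<Phi> t)"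
proof (rule linearI)
  show "sgad_map \<gamma>0 Nth r \<Phi> t (M + M') = sgad_map \<gamma>0 Nth r \<Phi> t M + sgad_map \<gamma>0 Nth r \<Phi> t M'"
    for M M'
    unfolding sgad_map_def matrix_add_ldistrib trace_add add_divide_distrib cscale_add
    by (simp only: add_ac)
  show "sgad_map \<gamma>0 Nth r \<Phi> t (k *\<^sub>R M) = k *\<^sub>R sgad_map \<gamma>0 Nth r \<Phi> t M" for k M
    unfolding cscale_of_real[symmetric] by (rule sgad_map_cscale)
qed

lemma sgad_channel_apply [simp]:
  "blinfun_apply (sgad_channel \<gamma>0 Nth r \<Phi> t) = sgad_map \<gamma>0 Nth r \<Phi> t"
  unfolding sgad_channel_def
  by (rule bounded_linear_Blinfun_apply) (simp add: linear_conv_bounded_linear[symmetric] linear_sgad_map)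

lemma sgad_map_basis:
  "sgad_map \<gamma>0 Nth r \<Phi> t (mat 1) = mat 1 - sgad_Y \<gamma>0 Nth r t *\<^sub>R sigma_z"
  "sgad_map \<gamma>0 Nth r \<Phi> t sigma_x =
     sgad_A \<gamma>0 Nth r \<Phi> t *\<^sub>R sigma_x - sgad_B \<gamma>0 Nth r \<Phi> t *\<^sub>R sigma_y"
  "sgad_map \<gamma>0 Nth r \<Phi> t sigma_y =
     - sgad_B \<gamma>0 Nth r \<Phi> t *\<^sub>R sigma_x + sgad_G \<gamma>0 Nth r \<Phi> t *\<^sub>R sigma_y"
  "sgad_map \<gamma>0 Nth r \<Phi> t sigma_z = sgad_H \<gamma>0 Nth r t *\<^sub>R sigma_z"
  by (simp_all add: sgad_map_def matrix2_simps)

lemma pauli_expansion: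
  "M = cscale (trace M / 2) (mat 1) + cscale (trace (sigma_x ** M) / 2) sigma_x +
       cscale (trace (sigma_y ** M) / 2) sigma_y + cscale (trace (sigma_z ** M) / 2) sigma_z"
  by (simp add: matrix2_simps) (simp add: field_simps)

lemma sgad_channel_characterization:
  "E = sgad_channel \<gamma>0 Nth r \<Phi> t \<longleftrightarrow>
     (\<forall>c M. blinfun_apply E (cscale c M) = cscale c (blinfun_apply E M)) \<and>
     blinfun_apply E (mat 1) = mat 1 - sgad_Y \<gamma>0 Nth r t *\<^sub>R sigma_z \<and>
     blinfun_apply E sigma_x =
       sgad_A \<gamma>0 Nth r \<Phi> t *\<^sub>R sigma_x - sgad_B \<gamma>0 Nth r \<Phi> t *\<^sub>R sigma_y \<and>
     blinfun_apply E sigma_y =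
       - sgad_B \<gamma>0 Nth r \<Phi> t *\<^sub>R sigma_x + sgad_G \<gamma>0 Nth r \<Phi> t *\<^sub>R sigma_y \<and>
     blinfun_apply E sigma_z = sgad_H \<gamma>0 Nth r t *\<^sub>R sigma_z"
  (is "?L \<longleftrightarrow> ?R")
proof
  assume ?L
  then show ?R by (simp add: sgad_map_cscale sgad_map_basis)
next
  assume R: ?R
  show ?L
  proof (rule blinfun_eqI)
    fix M
    have "blinfun_apply E M = blinfun_apply E
        (cscale (trace M / 2) (mat 1) + cscale (trace (sigma_x ** M) / 2) sigma_x +
         cscale (trace (sigma_y ** M) / 2) sigma_y + cscale (trace (sigma_z ** M) / 2) sigma_z)"
      using pauli_expansion[of M] by simp
    also have "\<dots> = sgad_map \<gamma>0 Nth r \<Phi> t M"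
      unfolding blinfun.add_right sgad_map_def using R by simp
    finally show "blinfun_apply E M = blinfun_apply (sgad_channel \<gamma>0 Nth r \<Phi> t) M"
      by simp
  qed
qed

lemma hermitian_iff: "hermitian M \<longleftrightarrow> (\<forall>i j. cnj (M $ i $ j) = M $ j $ i)"
  unfolding hermitian_def by (metis complex_cnj_cnj)

lemma hermitian_add: "hermitian M \<Longrightarrow> hermitian M' \<Longrightarrow> hermitian (M + M')"
  by (simp add: hermitian_iff)

lemma hermitian_scaleR: "hermitian M \<Longrightarrow> hermitian (k *\<^sub>R M)"
  by (simp add: hermitian_iff)

lemma cscale_scaleR: "k *\<^sub>R cscale c M = cscale c (k *\<^sub>R M)"
  by (simp add: cscale_def vec_eq_iff)

lemma subspace_hermiticity_preserving_maps: "subspace hermiticity_preserving_maps"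
  unfolding subspace_def hermiticity_preserving_maps_def
  by (simp add: blinfun.add_left blinfun.scaleR_left cscale_add_right cscale_scaleR
      hermitian_add hermitian_scaleR) (simp add: cscale_def hermitian_iff vec_eq_iff)

lemma hermitian_pauli: "hermitian (mat 1)" "hermitian sigma_x" "hermitian sigma_y" "hermitian sigma_z"
  by (simp_all add: hermitian_def matrix2_simps)

lemma hermitian_cscale: "c \<in> \<real> \<Longrightarrow> hermitian M \<Longrightarrow> hermitian (cscale c M)"
  by (elim Reals_cases) (simp add: cscale_of_real hermitian_scaleR)

lemma trace_mult_hermitian: "hermitian P \<Longrightarrow> hermitian M \<Longrightarrow> trace (P ** M) / 2 \<in> \<real>"
proof -
  assume "hermitian P" "hermitian M"
  then have "cnj (P $ i $ k * M $ k $ i) = M $ i $ k * P $ k $ i" for i k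
    by (simp add: hermitian_iff mult.commute)
  then have "cnj (trace (P ** M)) = trace (M ** P)"
    by (simp add: trace_def matrix_matrix_mult_def)
  then show ?thesis
    by (simp add: Reals_cnj_iff trace_mul_sym[of M P])
qed

lemma hermitian_sgad_map:
  assumes "hermitian M"
  shows "hermitian (sgad_map \<gamma>0 Nth r \<Phi> t M)"
proof -
  have minus: "X - k *\<^sub>R Z = X + (- k) *\<^sub>R Z" for k and X Z :: "complex^2^2"
    by simp
  have "trace M / 2 \<in> \<real>"
    using trace_mult_hermitian[OF hermitian_pauli(1) assms] by simp
  then show ?thesis
    unfolding sgad_map_def minus
    by (intro hermitian_add hermitian_cscale hermitian_scaleR hermitian_pauli
        trace_mult_hermitian assms)
qed

lemma sgad_channels_subset: "sgad_channels \<gamma>0 \<subseteq> hermiticity_preserving_maps"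
  by (auto simp: sgad_channels_def hermiticity_preserving_maps_def sgad_map_cscale
      hermitian_sgad_map)

end

(* The transverse block [[A, -B], [-B, G]] of an SGAD channel has determinant H. On the
   channels without squeezing, A = G = sqrt H and B = 0, and averaging the identity (H = 1) with
   one having H = h < 1 gives determinant ((1 + sqrt h) / 2)^2 instead of (1 + h) / 2. *)
theory Submission
  imports Defs
begin

text \<open>The factor \<open>exp (- u)\<close> makes the bracket symmetric in \<open>u\<close> and
  \<open>- u\<close>. Taking \<open>c\<close> as \<open>cos \<Phi>\<close> or
  \<open>- cos \<Phi>\<close> treats \<open>sgad_A\<close> and \<open>sgad_G\<close> alike.\<close>

lemma exp_double_cosh_sinh:
  "(1 + 1/2 * (exp (2 * u) - 1) * (1 + c)) * exp (- (s + u)) = (cosh u + c * sinh u) * exp (- s)"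
  for u c s :: real
proof -
  have "exp (2 * u) * exp (- u) = exp u"
    by (simp flip: exp_add)
  then have "(1 + 1/2 * (exp (2 * u) - 1) * (1 + c)) * exp (- u) =
      (exp (- u) + exp u) / 2 + c * ((exp u - exp (- u)) / 2)"
    by (simp add: algebra_simps add_divide_distrib diff_divide_distrib)
  then have "(1 + 1/2 * (exp (2 * u) - 1) * (1 + c)) * exp (- u) = cosh u + c * sinh u"
    by (simp add: cosh_field_def sinh_field_def add.commute)
  moreover have "exp (- (s + u)) = exp (- u) * exp (- s)"
    by (simp flip: exp_add)
  ultimately show ?thesis
    by (metis mult.assoc)
qed

text \<open>Up to the factor \<open>exp (- s)\<close>, the block is \<open>cosh u\<close> times the
  identity plus \<open>sinh u\<close> times the reflection [[cos \<Phi>, -sin \<Phi>],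
  [-sin \<Phi>, -cos \<Phi>]]. Its eigenvalues are then \<open>exp u\<close> and
  \<open>exp (- u)\<close>, with product 1.\<close>

lemma sgad_det: "sgad_A \<gamma>0 Nth r \<Phi> t * sgad_G \<gamma>0 Nth r \<Phi> t - (sgad_B \<gamma>0 Nth r \<Phi> t)\<^sup>2 = sgad_H \<gamma>0 Nth r t"
proof -
  define u where "u = \<gamma>0 * sgad_a Nth r * t / 2"
  define s where "s = \<gamma>0 * (2 * sgad_N Nth r + 1) * t / 2"
  have ex: "\<gamma>0 * sgad_a Nth r * t = 2 * u"
      "\<gamma>0 * (2 * sgad_N Nth r + 1 + sgad_a Nth r) * t / 2 = s + u"
    by (simp_all add: u_def s_def field_simps)
  have A: "sgad_A \<gamma>0 Nth r \<Phi> t = (cosh u + cos \<Phi> * sinh u) * exp (- s)"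
    unfolding sgad_A_def ex by (rule exp_double_cosh_sinh)
  have G: "sgad_G \<gamma>0 Nth r \<Phi> t = (cosh u - cos \<Phi> * sinh u) * exp (- s)"
    unfolding sgad_G_def ex using exp_double_cosh_sinh[of u "- cos \<Phi>" s] by simp
  have B: "sgad_B \<gamma>0 Nth r \<Phi> t = sin \<Phi> * sinh u * exp (- s)"
    by (simp add: sgad_B_def u_def s_def)
  have H: "sgad_H \<gamma>0 Nth r t = (exp (- s))\<^sup>2"
    by (simp add: sgad_H_def s_def flip: exp_double)
  have "(cosh u + cos \<Phi> * sinh u) * (cosh u - cos \<Phi> * sinh u) - (sin \<Phi> * sinh u)\<^sup>2 =
      (cosh u)\<^sup>2 - ((cos \<Phi>)\<^sup>2 + (sin \<Phi>)\<^sup>2) * (sinh u)\<^sup>2"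
    by algebra
  also have "\<dots> = 1"
    using cosh_square_eq[of u] by simp
  finally have "((cosh u + cos \<Phi> * sinh u) * (cosh u - cos \<Phi> * sinh u) - (sin \<Phi> * sinh u)\<^sup>2) *
      (exp (- s))\<^sup>2 = (exp (- s))\<^sup>2"
    by simp
  then show ?thesis
    unfolding A G B H by (simp add: power2_eq_square algebra_simps)
qed

text \<open>The upper right entry of x \<open>sigma_x\<close> + y \<open>sigma_y\<close> is x - iy,
  so a single entry carries both real coefficients.\<close>

lemma sgad_map_entries:
  "sgad_map \<gamma>0 Nth r \<Phi> t sigma_x $ 1 $ 2 = Complex (sgad_A \<gamma>0 Nth r \<Phi> t) (sgad_B \<gamma>0 Nth r \<Phi> t)"
  "sgad_map \<gamma>0 Nth r \<Phi> t sigma_y $ 1 $ 2 = Complex (- sgad_B \<gamma>0 Nth r \<Phi> t) (- sgad_G \<gamma>0 Nth r \<Phi> t)"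
  "sgad_map \<gamma>0 Nth r \<Phi> t sigma_z $ 1 $ 1 = of_real (sgad_H \<gamma>0 Nth r t)"
  unfolding sgad_map_basis by (simp_all add: sigma_x_def sigma_y_def sigma_z_def complex_eq_iff)

text \<open>The identity refers to \<open>E\<close> alone, so it can be tested on a mixture without
  knowing any parameters for it.\<close>

lemma sgad_channels_det:
  assumes "E \<in> sgad_channels \<gamma>0"
  shows "- Re (E sigma_x $ 1 $ 2) * Im (E sigma_y $ 1 $ 2) - (Im (E sigma_x $ 1 $ 2))\<^sup>2
    = Re (E sigma_z $ 1 $ 1)"
  using assms sgad_det by (auto simp: sgad_channels_def sgad_map_entries)

text \<open>This is amplitude damping at zero temperature, where \<open>sgad_N\<close> and
  \<open>sgad_a\<close> vanish.\<close>

lemma sgad_unsqueezed: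
  "sgad_A \<gamma>0 0 0 0 t = exp (- (\<gamma>0 * t / 2))"
  "sgad_G \<gamma>0 0 0 0 t = exp (- (\<gamma>0 * t / 2))"
  "sgad_B \<gamma>0 0 0 0 t = 0"
  "sgad_H \<gamma>0 0 0 t = (exp (- (\<gamma>0 * t / 2)))\<^sup>2"
  by (simp_all add: sgad_A_def sgad_G_def sgad_B_def sgad_H_def sgad_a_def sgad_N_def
      flip: exp_double)

theorem theorem1:
  fixes \<gamma>0 :: real
  assumes "\<gamma>0 > 0"
  shows "\<not> convex (sgad_channels \<gamma>0)"
proof
  assume conv: "convex (sgad_channels \<gamma>0)"
  \<comment> \<open>The common value of \<open>sgad_A\<close> and \<open>sgad_G\<close> at time 1;
    \<open>sgad_H\<close> is then \<open>q\<^sup>2\<close>.\<close>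
  define q where "q = exp (- (\<gamma>0 / 2))"
  let ?E = "(1/2) *\<^sub>R sgad_channel \<gamma>0 0 0 0 0 + (1/2) *\<^sub>R sgad_channel \<gamma>0 0 0 0 1"
  have "sgad_channel \<gamma>0 0 0 0 0 \<in> sgad_channels \<gamma>0" "sgad_channel \<gamma>0 0 0 0 1 \<in> sgad_channels \<gamma>0"
    unfolding sgad_channels_def by force+
  then have "?E \<in> sgad_channels \<gamma>0"
    using conv by (intro convexD) auto
  from sgad_channels_det[OF this] have "((1 + q) / 2)\<^sup>2 = (1 + q\<^sup>2) / 2"
    by (simp add: blinfun.add_left blinfun.scaleR_left sgad_map_entries sgad_unsqueezed
        power2_eq_square field_simps flip: q_def)
  \<comment> \<open>The two sides differ by a quarter of this square.\<close>
  then have "(1 - q)\<^sup>2 = 0"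
    by (simp add: power2_eq_square field_simps)
  \<comment> \<open>Positivity of \<open>\<gamma>0\<close> gives \<open>q\<close> < 1.\<close>
  then show False
    using assms by (simp add: q_def)
qed

end
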